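(* Let $\mathcal{C}$ be an arbitrary collection of corner-interval minors of $M$. Then the ideal $J_{\mathcal{C}}$ is a minimal prime of $I(\mathcal{C})$.
   Context: Let $K$ be a field and $M=(x_{ij})$ an $m\times n$ matrix of indeterminates. A 2-minor is $\delta=[a_1,a_2|b_1,b_2]$ with $a_1<a_2$, $b_1<b_2$; $f_\delta=x_{a_1b_1}x_{a_2b_2}-x_{a_1b_2}x_{a_2b_1}$. Its vertex set is $V(\delta)=\{x_{a_1b_1},x_{a_1b_2},x_{a_2b_1},x_{a_2b_2}\}$; its edges are the horizontal edges $\{x_{a_1b_1},x_{a_1b_2}\}$, $\{x_{a_2b_1},x_{a_2b_2}\}$ and the vertical edges $\{x_{a_1b_1},x_{a_2b_1}\}$, $\{x_{a_1b_2},x_{a_2b_2}\}$. It is a corner-interval minor if $b_1=1$. For a set $\mathcal{C}$ of 2-minors, $V(\mathcal{C})$ and $E(\mathcal{C})$ are the unions of the vertex sets and edge sets of its members, $S=K[x_{ij}\mid x_{ij}\in V(\mathcal{C})]$, and $I(\mathcal{C})=(f_\delta\mid\delta\in\mathcal{C})\subset S$. A vertical interval of $\mathcal{C}$ is a set of vertices of $V(\mathcal{C})$ lying in one column of $M$ such that any two of them are joined by a path of vertical edges of $\mathcal{C}$; it is maximal if it is not strictly contained in another vertical interval. (Maximal) horizontal intervals are defined analogously with rows and horizontal edges. Let $V_1,\dots,V_p$ and $H_1,\dots,H_q$ be the maximal vertical and maximal horizontal intervals of $\mathcal{C}$. $G(\mathcal{C})$ is the bipartite graph with vertices $v_1,\dots,v_p,h_1,\dots,h_q$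 and edges $\{h_i,v_j\}$ for $H_i\cap V_j\ne\emptyset$; in that case $H_i\cap V_j$ is a single vertex, denoted $x_{a_i b_j}$. For a cycle $\sigma:h_{i_1},v_{j_1},\dots,h_{i_r},v_{j_r}$ ($r\ge2$) in $G(\mathcal{C})$ put $f_\sigma=\prod_{k=1}^r x_{a_{i_k},b_{j_k}}-\prod_{k=1}^r x_{a_{i_{k+1}},b_{j_k}}$ with $i_{r+1}=i_1$. $J_{\mathcal{C}}\subset S$ is the ideal generated by all $f_\sigma$, $\sigma$ a cycle in $G(\mathcal{C})$. *)

theory Defs
  imports "HOL-Algebra.Ideal" "HOL-Library.Poly_Mapping"
begin

text \<open>The indeterminate in row \<open>i\<close> and column \<open>j\<close> is represented by its index pair \<open>(i, j)\<close>;
  rows are numbered \<open>1..m\<close> and columns \<open>1..n\<close>.\<close>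

type_synonym var = "nat \<times> nat"

type_synonym 'k mpol = "(var \<Rightarrow>\<^sub>0 nat) \<Rightarrow>\<^sub>0 'k"

definition indet :: "var \<Rightarrow> 'k::field mpol" where
  "indet v = Poly_Mapping.single (Poly_Mapping.single v 1) 1"

definition pvars :: "'k::field mpol \<Rightarrow> var set" where
  "pvars p = (\<Union>mon\<in>Poly_Mapping.keys p. Poly_Mapping.keys mon)"

definition poly_ring :: "var set \<Rightarrow> ('k::field mpol) ring" where
  "poly_ring A = \<lparr>carrier = {p. pvars p \<subseteq> A}, monoid.mult = (*), one = 1, zero = 0, add = (+)\<rparr>"

definition minimal_prime_of :: "'a set \<Rightarrow> 'a set \<Rightarrow> ('a, 'b) ring_scheme \<Rightarrow> bool" where
  "minimal_prime_of P I R \<longleftrightarrow>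
     primeideal P R \<and> I \<subseteq> P \<and> (\<forall>Q. primeideal Q R \<and> I \<subseteq> Q \<and> Q \<subseteq> P \<longrightarrow> Q = P)"


section \<open>Collections of 2-minors\<close>

datatype minor = Minor (row1: nat) (row2: nat) (col1: nat) (col2: nat)

definition is_minor :: "nat \<Rightarrow> nat \<Rightarrow> minor \<Rightarrow> bool" where
  "is_minor m n d \<longleftrightarrow>
     1 \<le> row1 d \<and> row1 d < row2 d \<and> row2 d \<le> m \<and> 1 \<le> col1 d \<and> col1 d < col2 d \<and> col2 d \<le> n"

definition corner_interval :: "minor \<Rightarrow> bool" where
  "corner_interval d \<longleftrightarrow> col1 d = 1"

definition f_minor :: "minor \<Rightarrow> 'k::field mpol" where
  "f_minor d = indet (row1 d, col1 d) * indet (row2 d, col2 d) - indet (row1 d, col2 d) * indet (row2 d, col1 d)"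

definition V_minor :: "minor \<Rightarrow> var set" where
  "V_minor d = {(row1 d, col1 d), (row1 d, col2 d), (row2 d, col1 d), (row2 d, col2 d)}"

definition hedges_minor :: "minor \<Rightarrow> var set set" where
  "hedges_minor d = {{(row1 d, col1 d), (row1 d, col2 d)}, {(row2 d, col1 d), (row2 d, col2 d)}}"

definition vedges_minor :: "minor \<Rightarrow> var set set" where
  "vedges_minor d = {{(row1 d, col1 d), (row2 d, col1 d)}, {(row1 d, col2 d), (row2 d, col2 d)}}"

definition verts :: "minor set \<Rightarrow> var set" where
  "verts C = (\<Union>d\<in>C. V_minor d)"

definition hedges :: "minor set \<Rightarrow> var set set" where
  "hedges C = (\<Union>d\<in>C. hedges_minor d)"

definition vedges :: "minor set \<Rightarrow> var set set" where
  "vedges C = (\<Union>d\<in>C. vedges_minor d)"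

definition S_ring :: "minor set \<Rightarrow> ('k::field mpol) ring" where
  "S_ring C = poly_ring (verts C)"

definition I_ideal :: "minor set \<Rightarrow> ('k::field mpol) set" where
  "I_ideal C = genideal (S_ring C) (f_minor ` C)"


section \<open>Maximal intervals and the graph of a collection\<close>

definition joined :: "var set set \<Rightarrow> var \<Rightarrow> var \<Rightarrow> bool" where
  "joined E = (\<lambda>u v. {u, v} \<in> E)\<^sup>*\<^sup>*"

definition vertical_interval :: "minor set \<Rightarrow> var set \<Rightarrow> bool" where
  "vertical_interval C A \<longleftrightarrow>
     A \<subseteq> verts C \<and> (\<exists>b. \<forall>x\<in>A. snd x = b) \<and> (\<forall>x\<in>A. \<forall>y\<in>A. joined (vedges C) x y)"

definition horizontal_interval :: "minor set \<Rightarrow> var set \<Rightarrow> bool" where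
  "horizontal_interval C A \<longleftrightarrow>
     A \<subseteq> verts C \<and> (\<exists>a. \<forall>x\<in>A. fst x = a) \<and> (\<forall>x\<in>A. \<forall>y\<in>A. joined (hedges C) x y)"

definition max_vertical :: "minor set \<Rightarrow> var set set" where
  "max_vertical C =
     {A. vertical_interval C A \<and> (\<nexists>B. vertical_interval C B \<and> A \<subset> B)}"

definition max_horizontal :: "minor set \<Rightarrow> var set set" where
  "max_horizontal C =
     {A. horizontal_interval C A \<and> (\<nexists>B. horizontal_interval C B \<and> A \<subset> B)}"

text \<open>The vertex \<open>h\<^sub>i\<close> of the bipartite graph is \<open>Inl H\<^sub>i\<close>, the vertex \<open>v\<^sub>j\<close> is \<open>Inr V\<^sub>j\<close>.\<close>

definition G_verts :: "minor set \<Rightarrow> (var set + var set) set" where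
  "G_verts C = Inl ` max_horizontal C \<union> Inr ` max_vertical C"

definition G_edges :: "minor set \<Rightarrow> (var set + var set) set set" where
  "G_edges C =
     {{Inl H, Inr W} | H W. H \<in> max_horizontal C \<and> W \<in> max_vertical C \<and> H \<inter> W \<noteq> {}}"

text \<open>\<open>hs = [H\<^sub>i\<^sub>1, \<dots>, H\<^sub>i\<^sub>r]\<close> and \<open>vs = [V\<^sub>j\<^sub>1, \<dots>, V\<^sub>j\<^sub>r]\<close> encode the cycle
  \<open>h\<^sub>i\<^sub>1, v\<^sub>j\<^sub>1, \<dots>, h\<^sub>i\<^sub>r, v\<^sub>j\<^sub>r\<close>; the lists are indexed from 0, so the cyclic successor of
  position \<open>k\<close> is \<open>Suc k mod r\<close>.\<close>

definition G_cycle :: "minor set \<Rightarrow> var set list \<Rightarrow> var set list \<Rightarrow> bool" where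
  "G_cycle C hs vs \<longleftrightarrow>
     length hs = length vs \<and> 2 \<le> length hs \<and> distinct hs \<and> distinct vs \<and>
     Inl ` set hs \<union> Inr ` set vs \<subseteq> G_verts C \<and>
     (\<forall>k<length hs. {Inl (hs ! k), Inr (vs ! k)} \<in> G_edges C \<and>
                    {Inr (vs ! k), Inl (hs ! (Suc k mod length hs))} \<in> G_edges C)"

definition f_cycle :: "var set list \<Rightarrow> var set list \<Rightarrow> 'k::field mpol" where
  "f_cycle hs vs =
     (\<Prod>k<length hs. indet (the_elem (hs ! k \<inter> vs ! k))) -
     (\<Prod>k<length hs. indet (the_elem (hs ! (Suc k mod length hs) \<inter> vs ! k)))"

definition J_ideal :: "minor set \<Rightarrow> ('k::field mpol) set" where
  "J_ideal C = genideal (S_ring C) {f_cycle hs vs | hs vs. G_cycle C hs vs}"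


section \<open>Well-definedness\<close>

lemma pvars_add: "pvars (p + q) \<subseteq> pvars p \<union> pvars q"
  unfolding pvars_def using Poly_Mapping.keys_add[of p q] by blast

lemma pvars_mult: "pvars (p * q) \<subseteq> pvars p \<union> pvars q"
proof
  fix v assume "v \<in> pvars (p * q)"
  then obtain c where "c \<in> Poly_Mapping.keys (p * q)" and v: "v \<in> Poly_Mapping.keys c"
    unfolding pvars_def by blast
  then obtain a b where ab: "a \<in> Poly_Mapping.keys p" "b \<in> Poly_Mapping.keys q" "c = a + b"
    using Poly_Mapping.keys_mult[of p q] by blast
  then have "v \<in> Poly_Mapping.keys a \<union> Poly_Mapping.keys b"
    using v Poly_Mapping.keys_add[of a b] by blast
  then show "v \<in> pvars p \<union> pvars q"
    using ab unfolding pvars_def by blast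
qed

lemma poly_ring_carrier:
  fixes p q :: "'k::field mpol"
  shows "0 \<in> carrier (poly_ring A)" "1 \<in> carrier (poly_ring A)"
    and "v \<in> A \<Longrightarrow> indet v \<in> carrier (poly_ring A)"
    and "p \<in> carrier (poly_ring A) \<Longrightarrow> - p \<in> carrier (poly_ring A)"
    and "p \<in> carrier (poly_ring A) \<Longrightarrow> q \<in> carrier (poly_ring A) \<Longrightarrow> p + q \<in> carrier (poly_ring A)"
    and "p \<in> carrier (poly_ring A) \<Longrightarrow> q \<in> carrier (poly_ring A) \<Longrightarrow> p - q \<in> carrier (poly_ring A)"
    and "p \<in> carrier (poly_ring A) \<Longrightarrow> q \<in> carrier (poly_ring A) \<Longrightarrow> p * q \<in> carrier (poly_ring A)"
proof -
  have uminus: "pvars (- q) = pvars q" for q :: "'k mpol"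
    by (simp add: pvars_def)
  show "p \<in> carrier (poly_ring A) \<Longrightarrow> q \<in> carrier (poly_ring A) \<Longrightarrow> p - q \<in> carrier (poly_ring A)"
    using pvars_add[of p "- q"] uminus[of q] by (auto simp: poly_ring_def)
  show "p \<in> carrier (poly_ring A) \<Longrightarrow> q \<in> carrier (poly_ring A) \<Longrightarrow> p + q \<in> carrier (poly_ring A)"
    using pvars_add[of p q] by (auto simp: poly_ring_def)
  show "p \<in> carrier (poly_ring A) \<Longrightarrow> q \<in> carrier (poly_ring A) \<Longrightarrow> p * q \<in> carrier (poly_ring A)"
    using pvars_mult[of p q] by (auto simp: poly_ring_def)
  show "p \<in> carrier (poly_ring A) \<Longrightarrow> - p \<in> carrier (poly_ring A)"
    by (simp add: poly_ring_def uminus)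
qed (simp_all add: poly_ring_def pvars_def indet_def)

lemma poly_ring_ops:
  "x \<oplus>\<^bsub>poly_ring A\<^esub> y = x + y" "x \<otimes>\<^bsub>poly_ring A\<^esub> y = x * y"
  "\<zero>\<^bsub>poly_ring A\<^esub> = 0" "\<one>\<^bsub>poly_ring A\<^esub> = 1"
  by (simp_all add: poly_ring_def)

lemma cring_poly_ring: "cring (poly_ring A :: ('k::field mpol) ring)"
proof (rule cringI)
  show "abelian_group (poly_ring A :: ('k mpol) ring)"
  proof (rule abelian_groupI)
    fix p :: "'k mpol"
    assume "p \<in> carrier (poly_ring A)"
    then show "\<exists>q\<in>carrier (poly_ring A). q \<oplus>\<^bsub>poly_ring A\<^esub> p = \<zero>\<^bsub>poly_ring A\<^esub>"
      by (intro bexI[of _ "- p"]) (simp_all add: poly_ring_ops poly_ring_carrier)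
  qed (simp_all add: poly_ring_ops poly_ring_carrier ac_simps)
  show "Group.comm_monoid (poly_ring A :: ('k mpol) ring)"
    by (rule comm_monoidI) (simp_all add: poly_ring_ops poly_ring_carrier ac_simps)
qed (simp add: poly_ring_ops ring_distribs)

lemma f_minor_in_S_ring:
  assumes "d \<in> C"
  shows "f_minor d \<in> carrier (S_ring C)"
proof -
  have "V_minor d \<subseteq> verts C"
    using assms by (auto simp: verts_def)
  then show ?thesis
    unfolding f_minor_def S_ring_def by (auto intro!: poly_ring_carrier simp: V_minor_def)
qed

lemma inter_max_intervals:
  assumes "H \<in> max_horizontal C" "W \<in> max_vertical C" "H \<inter> W \<noteq> {}"
  shows "\<exists>v\<in>verts C. H \<inter> W = {v}"
proof -
  obtain a b where ab: "\<forall>x\<in>H. fst x = a" "\<forall>x\<in>W. snd x = b" "H \<subseteq> verts C"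
    using assms(1,2)
    by (auto simp: max_horizontal_def max_vertical_def horizontal_interval_def vertical_interval_def)
  then have "x = (a, b)" if "x \<in> H \<inter> W" for x
    using that by (simp add: prod_eq_iff)
  then show ?thesis
    using assms(3) ab(3) by blast
qed

lemma f_cycle_in_S_ring:
  assumes "G_cycle C hs vs"
  shows "(f_cycle hs vs :: 'k::field mpol) \<in> carrier (S_ring C)"
proof -
  have "the_elem (H \<inter> W) \<in> verts C" if "{Inl H, Inr W} \<in> G_edges C" for H W
    using that inter_max_intervals[of H C W] by (auto simp: G_edges_def doubleton_eq_iff)
  then have mem: "the_elem (hs ! k \<inter> vs ! k) \<in> verts C"
      and mem_Suc: "the_elem (hs ! (Suc k mod length hs) \<inter> vs ! k) \<in> verts C" if "k < length hs" for k
    using assms that by (auto simp: G_cycle_def insert_commute)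
  have prod: "prod g K \<in> carrier (poly_ring A)"
    if "\<And>k. k \<in> K \<Longrightarrow> g k \<in> carrier (poly_ring A)" for g :: "nat \<Rightarrow> 'k mpol" and K A
    using that by (induction K rule: infinite_finite_induct) (simp_all add: poly_ring_carrier)
  show ?thesis
    unfolding f_cycle_def S_ring_def by (intro poly_ring_carrier prod mem mem_Suc) auto
qed

end

theory Submission
  imports Defs "HOL-Library.Nat_Bijection"
begin

text \<open>Send the variable at a vertex to the product of the variables attached to its maximal horizontal
  and its maximal vertical interval. The kernel of this monomial map into a domain is \<open>J\<close>: if two
  monomials have the same image, a walk in \<open>G(C)\<close> alternating between their variables closes up to a
  cycle \<open>\<sigma>\<close>, and \<open>f\<^sub>\<sigma>\<close> reduces the degree of their difference. Hence \<open>J\<close> is prime and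
  contains no monomial. If \<open>Q\<close> is a prime with \<open>I \<subseteq> Q \<subseteq> J\<close>, then every variable can be
  cancelled modulo \<open>Q\<close>; going along vertical edges,
  \<open>x\<^sub>a\<^sub>b x\<^sub>c\<^sub>1 \<equiv> x\<^sub>c\<^sub>b x\<^sub>a\<^sub>1\<close> whenever \<open>x\<^sub>a\<^sub>b\<close> and \<open>x\<^sub>c\<^sub>b\<close> lie in one vertical
  interval, and multiplying these relations along a cycle gives \<open>f\<^sub>\<sigma> \<in> Q\<close>.\<close>

section \<open>Ideals of the polynomial ring\<close>

lemma ideal_poly_ring:
  assumes "ideal I (poly_ring X)"
  shows ideal_poly_ring_zero: "0 \<in> I"
    and ideal_poly_ring_add: "p \<in> I \<Longrightarrow> q \<in> I \<Longrightarrow> p + q \<in> I"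
    and ideal_poly_ring_mult: "p \<in> I \<Longrightarrow> c \<in> carrier (poly_ring X) \<Longrightarrow> c * p \<in> I"
    and ideal_poly_ring_uminus: "p \<in> I \<Longrightarrow> - p \<in> I"
proof -
  interpret ideal I "poly_ring X" by fact
  show "0 \<in> I" using additive_subgroup.zero_closed[OF is_additive_subgroup] by (simp add: poly_ring_ops)
  show "p \<in> I \<Longrightarrow> q \<in> I \<Longrightarrow> p + q \<in> I" using additive_subgroup.a_closed[OF is_additive_subgroup] by (simp add: poly_ring_ops)
  show mult: "p \<in> I \<Longrightarrow> c \<in> carrier (poly_ring X) \<Longrightarrow> c * p \<in> I" for c
    using I_l_closed by (simp add: poly_ring_ops)
  show "p \<in> I \<Longrightarrow> - p \<in> I"
    using mult[of "- 1"] by (simp add: poly_ring_carrier)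
qed

lemma ideal_poly_ring_sum:
  assumes "ideal I (poly_ring X)" "\<And>t. t \<in> T \<Longrightarrow> g t \<in> I"
  shows "sum g T \<in> I"
  using assms(2)
  by (induction T rule: infinite_finite_induct)
    (auto intro: ideal_poly_ring_zero[OF assms(1)] ideal_poly_ring_add[OF assms(1)])

lemma ideal_poly_ringI:
  assumes sub: "I \<subseteq> carrier (poly_ring X)" and zero: "0 \<in> I"
    and add: "\<And>p q. p \<in> I \<Longrightarrow> q \<in> I \<Longrightarrow> p + q \<in> I"
    and mult: "\<And>p c. p \<in> I \<Longrightarrow> c \<in> carrier (poly_ring X) \<Longrightarrow> c * p \<in> I"
  shows "ideal I (poly_ring X)"
proof -
  interpret cring "poly_ring X" by (rule cring_poly_ring)
  show ?thesis
  proof (rule idealI)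
    show "ring (poly_ring X)" by (rule ring_axioms)
    show "subgroup I (add_monoid (poly_ring X))"
    proof (rule add.subgroupI)
      fix p assume p: "p \<in> I"
      have "p \<in> carrier (poly_ring X)" using p sub by blast
      then have "\<ominus>\<^bsub>poly_ring X\<^esub> p = - p"
        by (intro minus_equality) (simp_all add: poly_ring_ops poly_ring_carrier)
      moreover have "- p \<in> I"
        using mult[OF p, of "- 1"] by (simp add: poly_ring_carrier)
      ultimately show "\<ominus>\<^bsub>poly_ring X\<^esub> p \<in> I" by simp
    qed (use sub zero add in \<open>auto simp: poly_ring_ops\<close>)
  qed (use mult in \<open>auto simp: poly_ring_ops mult.commute\<close>)
qed

lemma single_in_poly_ring:
  "Poly_Mapping.keys t \<subseteq> X \<Longrightarrow> Poly_Mapping.single t c \<in> carrier (poly_ring X)"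
  by (auto simp: poly_ring_def pvars_def)

lemma prod_in_poly_ring:
  "(\<And>k. k \<in> K \<Longrightarrow> g k \<in> carrier (poly_ring X)) \<Longrightarrow> prod g K \<in> carrier (poly_ring X)"
  by (induction K rule: infinite_finite_induct) (simp_all add: poly_ring_carrier)


section \<open>Monomial maps\<close>

text \<open>The map of monoid algebras induced by \<open>D\<close>, kept additive only, for
  arbitrary \<open>D\<close>: \<open>push_kernel_subset\<close> also pushes along a choice of
  representatives, which need not respect sums.\<close>

definition push :: "('a \<Rightarrow> 'b) \<Rightarrow> ('a \<Rightarrow>\<^sub>0 'k) \<Rightarrow> ('b \<Rightarrow>\<^sub>0 'k::comm_monoid_add)" where
  "push D p = (\<Sum>t\<in>Poly_Mapping.keys p. Poly_Mapping.single (D t) (Poly_Mapping.lookup p t))"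

lemma push_add: "push D (p + q) = push D p + push D q"
  unfolding push_def by (rule setsum_keys_plus_distrib) (simp_all add: single_add)

lemma push_zero [simp]: "push D 0 = 0"
  by (simp add: push_def)

lemma push_single [simp]: "push D (Poly_Mapping.single t c) = Poly_Mapping.single (D t) c"
  by (simp add: push_def)

lemma push_sum: "push D (sum g T) = (\<Sum>t\<in>T. push D (g t))"
  by (induction T rule: infinite_finite_induct) (simp_all add: push_add)

lemma push_push: "push g (push f p) = push (\<lambda>t. g (f t)) p"
  by (simp add: push_def[of f] push_def[of "\<lambda>t. g (f t)"] push_sum)

lemma single_eq_0_iff [simp]: "Poly_Mapping.single t c = 0 \<longleftrightarrow> c = 0"
  by (metis lookup_single_eq lookup_zero single_zero)

lemma push_id: "push (\<lambda>t. t) p = p"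
  by (rule poly_mapping_eqI)
    (simp add: push_def lookup_sum lookup_single when_def sum.delta in_keys_iff)

lemma push_uminus:
  fixes p :: "'a \<Rightarrow>\<^sub>0 'k::ab_group_add"
  shows "push D (- p) = - push D p"
  by (metis push_add push_zero add.right_inverse minus_unique)

lemma push_diff:
  fixes p :: "'a \<Rightarrow>\<^sub>0 'k::ab_group_add"
  shows "push D (p - q) = push D p - push D q"
  by (metis push_add push_uminus add_uminus_conv_diff)

lemma push_mult:
  fixes p q :: "'a::comm_monoid_add \<Rightarrow>\<^sub>0 'k::comm_semiring_0"
    and D :: "'a \<Rightarrow> 'b::comm_monoid_add"
  assumes D: "\<And>s t. D (s + t) = D s + D t"
  shows "push D (p * q) = push D p * push D q"
proof -
  \<comment> \<open>By \<open>push_id\<close> both factors become sums of terms, and the claim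
    reduces to products of two terms.\<close>
  have "push D (push (\<lambda>t. t) p * push (\<lambda>t. t) q) = push D p * push D q"
    unfolding push_def[of "\<lambda>t. t"] push_def[of D p] push_def[of D q]
    by (simp add: sum_product push_sum mult_single D)
  then show ?thesis
    by (simp add: push_id)
qed


section \<open>Alternating cycles\<close>

text \<open>A variable is regarded as an edge joining its two classes \<open>h x\<close> and \<open>v x\<close>; the edges of a
  cycle are listed alternately in \<open>es\<close> and \<open>fs\<close>.\<close>

definition alt_cycle :: "('a \<Rightarrow> nat) \<Rightarrow> ('a \<Rightarrow> nat) \<Rightarrow> 'a list \<Rightarrow> 'a list \<Rightarrow> bool" where
  "alt_cycle h v es fs \<longleftrightarrow>
     length es = length fs \<and> 2 \<le> length es \<and> distinct (map h es) \<and> distinct (map v es) \<and>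
     (\<forall>k<length es. v (fs ! k) = v (es ! k) \<and> h (fs ! k) = h (es ! (Suc k mod length es)))"

text \<open>An injective self-map of a finite set is bijective. The rotation serves to reindex sums
  and products along a cycle.\<close>

lemma bij_betw_Suc_mod: "bij_betw (\<lambda>k. Suc k mod r) {..<r} {..<r}"
proof -
  have "inj_on (\<lambda>k. Suc k mod r) {..<r}"
    by (auto simp: inj_on_def mod_Suc split: if_splits)
  moreover have "(\<lambda>k. Suc k mod r) ` {..<r} \<subseteq> {..<r}"
    by (cases "r = 0") auto
  ultimately show ?thesis
    by (simp add: bij_betw_def endo_inj_surj)
qed

lemma alt_cycle_distinct_snd:
  assumes "alt_cycle h v es fs"
  shows "distinct fs"
proof -
  have "map v fs = map v es"
    using assms by (intro nth_equalityI) (auto simp: alt_cycle_def)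
  then show ?thesis
    using assms distinct_map[of v fs] by (simp add: alt_cycle_def)
qed

text \<open>By pigeonhole the orbit of \<open>x\<close> revisits a point \<open>y\<close>; taking
  the least period of \<open>y\<close> makes its iterates distinct.\<close>

lemma exists_periodic:
  fixes n :: "'a \<Rightarrow> 'a"
  assumes "finite A" "x \<in> A" "n ` A \<subseteq> A"
  obtains y r where "y \<in> A" "0 < r" "(n ^^ r) y = y" "inj_on (\<lambda>k. (n ^^ k) y) {..<r}"
proof -
  have in_A: "(n ^^ k) x \<in> A" for k
    by (induction k) (use assms in auto)
  have "\<not> inj (\<lambda>k. (n ^^ k) x)"
    using assms(1) in_A finite_imageD[of "\<lambda>k. (n ^^ k) x" UNIV] finite_subset[of "range (\<lambda>k. (n ^^ k) x)" A]
    by auto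
  then obtain i j where ij: "i < j" "(n ^^ i) x = (n ^^ j) x"
    by (metis (mono_tags, lifting) injI linorder_neqE_nat)
  define y where "y = (n ^^ i) x"
  have "(n ^^ (j - i)) y = y"
    using ij funpow_add[of "j - i" i n] by (simp add: y_def)
  then have ex: "\<exists>r. 0 < r \<and> (n ^^ r) y = y"
    using ij(1) by (intro exI[of _ "j - i"]) simp
  define r where "r = (LEAST r. 0 < r \<and> (n ^^ r) y = y)"
  have r: "0 < r" "(n ^^ r) y = y"
    using LeastI_ex[OF ex] by (auto simp: r_def)
  have least: "r \<le> s" if "0 < s" "(n ^^ s) y = y" for s
    unfolding r_def using that by (intro Least_le) simp
  have "(n ^^ a) y \<noteq> (n ^^ b) y" if "a < b" "b < r" for a b
  proof
    assume eq: "(n ^^ a) y = (n ^^ b) y"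
    \<comment> \<open>Applying \<open>n\<close> another \<open>r - b\<close> times to both sides
      produces the smaller period \<open>r - b + a\<close>.\<close>
    have "(n ^^ (r - b + a)) y = (n ^^ (r - b + b)) y"
      by (simp add: funpow_add eq)
    then have "(n ^^ (r - b + a)) y = y"
      using that r by simp
    then have "r \<le> r - b + a"
      using that by (intro least) auto
    then show False using that by simp
  qed
  then have "inj_on (\<lambda>k. (n ^^ k) y) {..<r}"
    by (metis (mono_tags, lifting) inj_onI lessThan_iff linorder_neqE_nat)
  with r show ?thesis
    by (intro that[of y r]) (auto simp: y_def in_A)
qed

text \<open>The edge leaving an \<open>h\<close>-class through \<open>A\<close> and the edge leaving a \<open>v\<close>-class through \<open>B\<close> are
  chosen as functions of the class alone, so that periodicity of the walk on the \<open>h\<close>-classes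
  also makes the \<open>v\<close>-classes distinct.\<close>

lemma exists_alt_cycle:
  fixes h v :: "'a \<Rightarrow> nat"
  assumes fin: "finite A" and ne: "A \<noteq> {}"
    and vAB: "v ` A \<subseteq> v ` B" and hBA: "h ` B \<subseteq> h ` A"
    and disj: "\<And>a b. a \<in> A \<Longrightarrow> b \<in> B \<Longrightarrow> h a = h b \<Longrightarrow> v a = v b \<Longrightarrow> False"
  obtains es fs where "alt_cycle h v es fs" "set es \<subseteq> A" "set fs \<subseteq> B"
proof -
  define c where "c = inv_into A h"
  define f where "f = inv_into B v"
  define n where "n y = h (f (v (c y)))" for y
  have c: "c y \<in> A" "h (c y) = y" if "y \<in> h ` A" for y
    using that by (simp_all add: c_def inv_into_into f_inv_into_f)
  have f: "f z \<in> B" "v (f z) = z" if "z \<in> v ` A" for z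
    using that vAB unfolding f_def by (meson inv_into_into f_inv_into_f subsetD)+
  have n: "n y \<in> h ` A" if "y \<in> h ` A" for y
    using that c f hBA unfolding n_def by blast
  obtain a where "a \<in> A" using ne by blast
  then have "finite (h ` A)" "h a \<in> h ` A" "n ` h ` A \<subseteq> h ` A"
    using fin n by auto
  then obtain y r where y: "y \<in> h ` A" "0 < r" "(n ^^ r) y = y" "inj_on (\<lambda>k. (n ^^ k) y) {..<r}"
    by (rule exists_periodic)
  have ny: "(n ^^ k) y \<in> h ` A" for k
    by (induction k) (use y(1) n in auto)
  define es where "es = map (\<lambda>k. c ((n ^^ k) y)) [0..<r]"
  define fs where "fs = map (\<lambda>k. f (v (c ((n ^^ k) y)))) [0..<r]"
  \<comment> \<open>Periodicity closes the walk, so exponents may be read modulo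
    \<open>r\<close>.\<close>
  have rot: "(n ^^ Suc k) y = (n ^^ (Suc k mod r)) y" if "k < r" for k
    using that y(3) by (cases "Suc k = r") (auto simp del: funpow.simps)
  \<comment> \<open>Equal \<open>v\<close>-classes lead to equal next \<open>h\<close>-classes;
    these are distinct within a period, and rotation is injective.\<close>
  have "inj_on (\<lambda>k. v (c ((n ^^ k) y))) {..<r}"
  proof (rule inj_onI)
    fix i j assume ij: "i \<in> {..<r}" "j \<in> {..<r}" "v (c ((n ^^ i) y)) = v (c ((n ^^ j) y))"
    then have "(n ^^ Suc i) y = (n ^^ Suc j) y"
      by (simp add: n_def)
    then have "(n ^^ (Suc i mod r)) y = (n ^^ (Suc j mod r)) y"
      using ij rot by simp
    then have "Suc i mod r = Suc j mod r"
      using y(2,4) by (auto dest: inj_onD)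
    then show "i = j"
      using bij_betw_imp_inj_on[OF bij_betw_Suc_mod] ij by (auto dest: inj_onD)
  qed
  \<comment> \<open>A cycle of length 1 would be an edge of \<open>A\<close> and an edge of
    \<open>B\<close> between the same two classes, against \<open>disj\<close>.\<close>
  moreover have "r \<noteq> 1"
  proof
    assume "r = 1"
    then have "h (f (v (c y))) = y"
      using y(3) by (simp add: n_def)
    then show False
      using disj[of "c y" "f (v (c y))"] c[OF y(1)] f[of "v (c y)"] by auto
  qed
  moreover have "h (fs ! k) = h (es ! (Suc k mod r))" if "k < r" for k
    using that rot[OF that] c ny y(2) by (simp add: es_def fs_def n_def)
  ultimately have "alt_cycle h v es fs"
    using y(2,4) c(2)[OF ny] f(2)[OF imageI[OF c(1)[OF ny]]]
    by (simp add: alt_cycle_def es_def fs_def distinct_map comp_def atLeast0LessThan)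
  moreover have "set es \<subseteq> A" "set fs \<subseteq> B"
    using c(1)[OF ny] f(1)[OF imageI[OF c(1)[OF ny]]] by (auto simp: es_def fs_def)
  ultimately show ?thesis using that by blast
qed


section \<open>The toric ideal of a bipartite graph\<close>

text \<open>The even coordinates of \<open>mdeg h v\<close> record the \<open>h\<close>-classes, the odd ones the \<open>v\<close>-classes.\<close>

definition mdeg :: "('a \<Rightarrow> nat) \<Rightarrow> ('a \<Rightarrow> nat) \<Rightarrow> ('a \<Rightarrow>\<^sub>0 nat) \<Rightarrow> (nat \<Rightarrow>\<^sub>0 nat)" where
  "mdeg h v t = (\<Sum>x\<in>Poly_Mapping.keys t. Poly_Mapping.single (2 * h x) (Poly_Mapping.lookup t x) +
     Poly_Mapping.single (Suc (2 * v x)) (Poly_Mapping.lookup t x))"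

lemma mdeg_add: "mdeg h v (s + t) = mdeg h v s + mdeg h v t"
  unfolding mdeg_def by (rule setsum_keys_plus_distrib) (simp_all add: single_add add_ac)

lemma mdeg_zero [simp]: "mdeg h v 0 = 0"
  by (simp add: mdeg_def)

lemma mdeg_sum: "mdeg h v (sum g T) = (\<Sum>t\<in>T. mdeg h v (g t))"
  by (induction T rule: infinite_finite_induct) (simp_all add: mdeg_add)

lemma mdeg_single [simp]:
  "mdeg h v (Poly_Mapping.single x c) =
     Poly_Mapping.single (2 * h x) c + Poly_Mapping.single (Suc (2 * v x)) c"
  by (simp add: mdeg_def)

text \<open>Exponents are natural numbers, so nothing cancels in the sum, and parity keeps the two
  kinds of classes apart.\<close>

lemma lookup_mdeg:
  "Poly_Mapping.lookup (mdeg h v t) (2 * a) \<noteq> 0 \<longleftrightarrow> a \<in> h ` Poly_Mapping.keys t"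
  "Poly_Mapping.lookup (mdeg h v t) (Suc (2 * a)) \<noteq> 0 \<longleftrightarrow> a \<in> v ` Poly_Mapping.keys t"
proof -
  have [simp]: "2 * (x::nat) \<noteq> Suc (2 * y)" "Suc (2 * y) \<noteq> 2 * x" for x y
    by presburger+
  show "Poly_Mapping.lookup (mdeg h v t) (2 * a) \<noteq> 0 \<longleftrightarrow> a \<in> h ` Poly_Mapping.keys t"
       "Poly_Mapping.lookup (mdeg h v t) (Suc (2 * a)) \<noteq> 0 \<longleftrightarrow> a \<in> v ` Poly_Mapping.keys t"
    by (auto simp: mdeg_def lookup_sum lookup_add lookup_single when_def in_keys_iff
        sum_eq_0_iff image_iff)
qed

text \<open>Provides the inclusions between classes that \<open>exists_alt_cycle\<close> asks
  for.\<close>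

lemma mdeg_eq_imp_images_eq:
  assumes "mdeg h v s = mdeg h v t"
  shows "h ` Poly_Mapping.keys s = h ` Poly_Mapping.keys t"
    and "v ` Poly_Mapping.keys s = v ` Poly_Mapping.keys t"
  using lookup_mdeg[of h v s] lookup_mdeg[of h v t] unfolding assms by blast+

section \<open>Monomials from lists of variables\<close>

definition lmon :: "'a list \<Rightarrow> ('a \<Rightarrow>\<^sub>0 nat)" where
  "lmon xs = (\<Sum>k<length xs. Poly_Mapping.single (xs ! k) 1)"

lemma prod_indet: "(\<Prod>k<length xs. indet (xs ! k)) = (Poly_Mapping.single (lmon xs) 1 :: 'k::field mpol)"
proof -
  have "(\<Prod>k\<in>K. indet (xs ! k) :: 'k mpol) =
      Poly_Mapping.single (\<Sum>k\<in>K. Poly_Mapping.single (xs ! k) 1) 1" if "finite K" for K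
    using that by induction (simp_all add: indet_def mult_single)
  then show ?thesis by (simp add: lmon_def)
qed

lemma lookup_lmon:
  assumes "distinct xs"
  shows "Poly_Mapping.lookup (lmon xs) x = (if x \<in> set xs then 1 else 0)"
proof -
  have "Poly_Mapping.lookup (lmon xs) x = card {k. k < length xs \<and> xs ! k = x}"
    by (simp add: lmon_def lookup_sum lookup_single when_def sum.If_cases Int_def)
  also have "\<dots> = (if x \<in> set xs then 1 else 0)"
  proof (cases "x \<in> set xs")
    case True
    then obtain i where "i < length xs" "xs ! i = x" by (auto simp: in_set_conv_nth)
    then have "{k. k < length xs \<and> xs ! k = x} = {i}"
      using assms nth_eq_iff_index_eq by blast
    then show ?thesis using True by simp
  qed (auto simp: in_set_conv_nth)
  finally show ?thesis .
qed

lemma keys_lmon: "distinct xs \<Longrightarrow> Poly_Mapping.keys (lmon xs) = set xs"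
  by (auto simp: in_keys_iff lookup_lmon split: if_splits)

lemma lmon_eq_0_iff: "distinct xs \<Longrightarrow> lmon xs = 0 \<longleftrightarrow> xs = []"
  using keys_lmon[of xs] by (simp flip: keys_eq_empty)

text \<open>The exponents of \<open>lmon xs\<close> are at most 1 and nonzero only at variables of
  \<open>t\<close>, so the truncated difference \<open>t - lmon xs\<close> is an exact
  cofactor.\<close>

lemma lmon_dvd:
  assumes "distinct xs" "set xs \<subseteq> Poly_Mapping.keys t"
  obtains u where "t = lmon xs + u"
proof -
  have "t = lmon xs + (t - lmon xs)"
    using assms by (intro poly_mapping_eqI)
      (auto simp: lookup_add lookup_minus lookup_lmon in_keys_iff Suc_le_eq)
  then show ?thesis by (rule that)
qed

text \<open>The \<open>v\<close>-parts agree position by position, the \<open>h\<close>-parts after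
  a rotation of the cycle.\<close>

lemma mdeg_alt_cycle:
  assumes "alt_cycle h v es fs"
  shows "mdeg h v (lmon es) = mdeg h v (lmon fs)"
proof -
  let ?r = "length es"
  have "(\<Sum>k<?r. Poly_Mapping.single (2 * h (fs ! k)) (1::nat)) =
      (\<Sum>k<?r. Poly_Mapping.single (2 * h (es ! (Suc k mod ?r))) 1)"
    using assms by (intro sum.cong) (auto simp: alt_cycle_def)
  also have "\<dots> = (\<Sum>k<?r. Poly_Mapping.single (2 * h (es ! k)) 1)"
    by (rule sum.reindex_bij_betw[OF bij_betw_Suc_mod])
  finally show ?thesis
    using assms by (simp add: lmon_def mdeg_sum sum.distrib alt_cycle_def)
qed

text \<open>If the two monomials have no common variable, then the edges of an alternating cycle divide
  the first and the second monomial respectively; subtracting a multiple of its binomial leaves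
  a multiple of a binomial of smaller degree.\<close>

lemma binomial_in_ideal:
  fixes J :: "'k::field mpol set"
  assumes J: "ideal J (poly_ring X)"
    and inj: "\<And>x y. x \<in> X \<Longrightarrow> y \<in> X \<Longrightarrow> h x = h y \<Longrightarrow> v x = v y \<Longrightarrow> x = y"
    and cycles: "\<And>es fs. alt_cycle h v es fs \<Longrightarrow> set es \<subseteq> X \<Longrightarrow> set fs \<subseteq> X \<Longrightarrow>
      Poly_Mapping.single (lmon es) 1 - Poly_Mapping.single (lmon fs) 1 \<in> J"
    and "Poly_Mapping.keys s \<subseteq> X" "Poly_Mapping.keys t \<subseteq> X" "mdeg h v s = mdeg h v t"
  shows "Poly_Mapping.single s 1 - Poly_Mapping.single t 1 \<in> J"
proof -
  define deg where "deg s = (\<Sum>x\<in>Poly_Mapping.keys s. Poly_Mapping.lookup s x)"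
    for s :: "var \<Rightarrow>\<^sub>0 nat"
  have deg_add: "deg (a + b) = deg a + deg b" for a b
    unfolding deg_def by (rule setsum_keys_plus_distrib[where f = "\<lambda>_ y. y"]) simp_all
  have deg_pos: "0 < deg a" if "a \<noteq> 0" for a
  proof -
    have "Poly_Mapping.keys a \<noteq> {}" using that by simp
    then show ?thesis unfolding deg_def by (intro sum_pos) (auto simp: in_keys_iff)
  qed
  have keys_add_nat: "Poly_Mapping.keys (a + b) = Poly_Mapping.keys a \<union> Poly_Mapping.keys b"
    for a b :: "var \<Rightarrow>\<^sub>0 nat"
    by (auto simp: in_keys_iff lookup_add)
  show ?thesis
    using assms(4-)
  proof (induction "deg s" arbitrary: s t rule: less_induct)
    case less
    \<comment> \<open>A common factor \<open>w\<close> splits off; the cofactors satisfy the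
      induction hypothesis because the total degree drops.\<close>
    have factor: "Poly_Mapping.single (w + a) 1 - Poly_Mapping.single (w + b) 1 \<in> J"
      if "w \<noteq> 0" "Poly_Mapping.keys (w + a) \<subseteq> X" "Poly_Mapping.keys b \<subseteq> X" "deg s = deg (w + a)"
        "mdeg h v a = mdeg h v b" for w a b
    proof -
      have "Poly_Mapping.single a 1 - Poly_Mapping.single b 1 \<in> J"
        using that deg_pos[of w] by (intro less.hyps) (auto simp: deg_add keys_add_nat)
      then have "Poly_Mapping.single w 1 * (Poly_Mapping.single a 1 - Poly_Mapping.single b 1) \<in> J"
        using that by (intro ideal_poly_ring_mult[OF J] single_in_poly_ring) (auto simp: keys_add_nat)
      then show ?thesis
        by (simp add: right_diff_distrib mult_single)
    qed
    show ?case
    proof (cases "Poly_Mapping.keys s \<inter> Poly_Mapping.keys t = {}")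
      case False
      then obtain x where x: "x \<in> Poly_Mapping.keys s" "x \<in> Poly_Mapping.keys t" by blast
      have x': "distinct [x]" "set [x] \<subseteq> Poly_Mapping.keys s" "set [x] \<subseteq> Poly_Mapping.keys t"
        using x by auto
      obtain a where a: "s = lmon [x] + a" by (rule lmon_dvd[OF x'(1,2)])
      obtain b where b: "t = lmon [x] + b" by (rule lmon_dvd[OF x'(1,3)])
      have "lmon [x] \<noteq> 0"
        by (simp add: lmon_eq_0_iff)
      then show ?thesis
        unfolding a b using less.prems by (intro factor) (auto simp: a b keys_add_nat mdeg_add)
    next
      case disj: True
      show ?thesis
      proof (cases "s = 0")
        case True
        then have "t = 0"
          using mdeg_eq_imp_images_eq(1)[OF less.prems(3)] by simp
        then show ?thesis
          using True ideal_poly_ring_zero[OF J] by simp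
      next
        case False
        obtain es fs where cyc: "alt_cycle h v es fs"
            "set es \<subseteq> Poly_Mapping.keys s" "set fs \<subseteq> Poly_Mapping.keys t"
        proof (rule exists_alt_cycle)
          show "Poly_Mapping.keys s \<noteq> {}" using False by simp
          show "False" if "a \<in> Poly_Mapping.keys s" "b \<in> Poly_Mapping.keys t" "h a = h b" "v a = v b" for a b
            using that inj[of a b] less.prems disj by blast
        qed (use mdeg_eq_imp_images_eq[OF less.prems(3)] in auto)
        have dist: "distinct es" "distinct fs"
          using cyc(1) alt_cycle_distinct_snd[OF cyc(1)] by (auto simp: alt_cycle_def distinct_map)
        obtain a where a: "s = lmon es + a" by (rule lmon_dvd[OF dist(1) cyc(2)])
        obtain b where b: "t = lmon fs + b" by (rule lmon_dvd[OF dist(2) cyc(3)])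
        have deg_eq: "mdeg h v a = mdeg h v b"
          using less.prems(3) mdeg_alt_cycle[OF cyc(1)] by (simp add: a b mdeg_add)
        have es_ne: "lmon es \<noteq> 0"
          using cyc(1) dist(1) by (auto simp: alt_cycle_def lmon_eq_0_iff)
        \<comment> \<open>With e and f the monomials of \<open>es\<close> and \<open>fs\<close>, the
          splitting used is e*a - f*b = a*(e - f) + f*(a - b).\<close>
        have "Poly_Mapping.single a 1 * (Poly_Mapping.single (lmon es) 1 - Poly_Mapping.single (lmon fs) 1) \<in> J"
          using less.prems(1,2) cyc
          by (intro ideal_poly_ring_mult[OF J] single_in_poly_ring cycles) (auto simp: a b keys_add_nat)
        moreover have "Poly_Mapping.single (lmon fs) 1 * (Poly_Mapping.single a 1 - Poly_Mapping.single b 1) \<in> J"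
          using less.prems(1,2) deg_pos[OF es_ne] deg_eq
          by (intro ideal_poly_ring_mult[OF J] single_in_poly_ring less.hyps)
            (auto simp: a b deg_add keys_add_nat)
        ultimately have "Poly_Mapping.single a 1 * (Poly_Mapping.single (lmon es) 1 - Poly_Mapping.single (lmon fs) 1)
            + Poly_Mapping.single (lmon fs) 1 * (Poly_Mapping.single a 1 - Poly_Mapping.single b 1) \<in> J"
          by (rule ideal_poly_ring_add[OF J])
        then show ?thesis
          by (simp add: right_diff_distrib mult_single a b add.commute)
      qed
    qed
  qed
qed

text \<open>In the kernel the coefficients over each fibre of \<open>D\<close> sum to zero.
  Replacing every monomial by a representative of its fibre turns \<open>p\<close> into zero, so
  \<open>p\<close> is a combination of differences within fibres.\<close>

lemma push_kernel_subset:
  fixes J :: "'k::field mpol set"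
  assumes J: "ideal J (poly_ring X)"
    and binom: "\<And>s t. Poly_Mapping.keys s \<subseteq> X \<Longrightarrow> Poly_Mapping.keys t \<subseteq> X \<Longrightarrow> D s = D t \<Longrightarrow>
      Poly_Mapping.single s 1 - Poly_Mapping.single t 1 \<in> J"
    and p: "p \<in> carrier (poly_ring X)" "push D p = 0"
  shows "p \<in> J"
proof -
  let ?K = "Poly_Mapping.keys p"
  define rep where "rep = inv_into ?K D"
  have rep: "rep (D t) \<in> ?K" "D (rep (D t)) = D t" if "t \<in> ?K" for t
    using that by (simp_all add: rep_def inv_into_into f_inv_into_f)
  have supp: "Poly_Mapping.keys t \<subseteq> X" if "t \<in> ?K" for t
    using that p(1) by (auto simp: poly_ring_def pvars_def)
  \<comment> \<open>The subtracted term is zero because \<open>push D p = 0\<close>.\<close>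
  have "p = push (\<lambda>t. t) p - push rep (push D p)"
    by (simp add: push_id p(2))
  also have "\<dots> = (\<Sum>t\<in>?K. Poly_Mapping.single 0 (Poly_Mapping.lookup p t) *
      (Poly_Mapping.single t 1 - Poly_Mapping.single (rep (D t)) 1))"
    unfolding push_push unfolding push_def
    by (simp add: sum_subtractf right_diff_distrib mult_single)
  also have "\<dots> \<in> J"
    using supp rep
    by (intro ideal_poly_ring_sum[OF J] ideal_poly_ring_mult[OF J] binom single_in_poly_ring) auto
  finally show ?thesis .
qed

lemma ideal_push_kernel:
  fixes D :: "(var \<Rightarrow>\<^sub>0 nat) \<Rightarrow> 'b::comm_monoid_add"
  assumes D: "\<And>s t. D (s + t) = D s + D t"
  shows "ideal {p \<in> carrier (poly_ring X). push D p = 0} (poly_ring X)"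
  by (rule ideal_poly_ringI) (auto simp: poly_ring_carrier push_add push_mult[of D, OF D])

text \<open>The target has no zero divisors: its exponents are finitely supported functions from
  \<open>nat\<close> to \<open>nat\<close>, which carry a linear order compatible with addition.
  Classes are therefore numbered by \<open>ccode\<close> below.\<close>

lemma primeideal_push_kernel:
  fixes D :: "(var \<Rightarrow>\<^sub>0 nat) \<Rightarrow> (nat \<Rightarrow>\<^sub>0 nat)"
  assumes D: "\<And>s t. D (s + t) = D s + D t"
  shows "primeideal {p \<in> carrier (poly_ring X). push D (p :: 'k::field mpol) = 0} (poly_ring X)"
proof (rule primeidealI)
  have "push D (1 :: 'k mpol) = Poly_Mapping.single (D 0) 1"
    by (metis push_single single_one)
  then have "1 \<notin> {p \<in> carrier (poly_ring X). push D (p :: 'k mpol) = 0}"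
    by simp
  then show "carrier (poly_ring X) \<noteq> {p \<in> carrier (poly_ring X). push D (p :: 'k mpol) = 0}"
    using poly_ring_carrier(2) by blast
qed (auto intro: ideal_push_kernel D cring_poly_ring simp: poly_ring_ops push_mult[of D, OF D])


section \<open>Maximal intervals as connected classes\<close>

abbreviation conn :: "var set set \<Rightarrow> var \<Rightarrow> var set" where
  "conn E x \<equiv> Collect (joined E x)"

lemma joined_refl [simp]: "joined E x x"
  by (simp add: joined_def)

lemma joined_trans: "joined E x y \<Longrightarrow> joined E y z \<Longrightarrow> joined E x z"
  by (simp add: joined_def)

lemma joined_sym: "joined E x y \<Longrightarrow> joined E y x"
  unfolding joined_def
proof (induction rule: rtranclp_induct)
  case (step y z)
  then have "{z, y} \<in> E" by (simp add: insert_commute)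
  then show ?case using step.IH by (rule converse_rtranclp_into_rtranclp)
qed simp

lemma conn_eq_iff: "conn E x = conn E y \<longleftrightarrow> joined E x y"
proof
  assume "conn E x = conn E y"
  then have "y \<in> conn E x" by simp
  then show "joined E x y" by simp
next
  assume "joined E x y"
  then show "conn E x = conn E y"
    using joined_trans[of E] joined_sym[of E x y] by (intro Collect_cong iffI) metis+
qed

text \<open>Treats both directions at once, with \<pi> the column or the row index. Edges preserve
  \<pi> and stay in \<open>X\<close>, so the class of \<open>x\<close> is an interval, and it
  contains every interval through \<open>x\<close>.\<close>

lemma max_interval_iff:
  assumes E: "\<And>u w. {u, w} \<in> E \<Longrightarrow> w \<in> X \<and> \<pi> u = \<pi> w" and x: "x \<in> X"
    and P: "\<And>A. P A \<longleftrightarrow> A \<subseteq> X \<and> (\<exists>b. \<forall>y\<in>A. \<pi> y = b) \<and> (\<forall>y\<in>A. \<forall>z\<in>A. joined E y z)"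
  shows "x \<in> A \<and> P A \<and> (\<nexists>B. P B \<and> A \<subset> B) \<longleftrightarrow> A = conn E x"
proof -
  have dir: "y \<in> X \<and> \<pi> y = \<pi> x" if "joined E x y" for y
    using that unfolding joined_def
  proof induction
    case (step y z)
    then show ?case using E[of y z] by simp
  qed (use x in simp)
  have "joined E y z" if "joined E x y" "joined E x z" for y z
    using joined_trans[OF joined_sym[OF that(1)] that(2)] .
  then have conn: "P (conn E x)"
    unfolding P using dir by blast
  have sub: "B \<subseteq> conn E x" if "x \<in> B" "P B" for B
    using that unfolding P by auto
  show ?thesis
  proof
    assume A: "x \<in> A \<and> P A \<and> (\<nexists>B. P B \<and> A \<subset> B)"
    then have "A \<subseteq> conn E x" by (intro sub) auto
    then show "A = conn E x" using A conn by (auto simp: psubset_eq)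
  next
    assume A: "A = conn E x"
    have "\<not> conn E x \<subset> B" if "P B" for B
      using sub[OF _ that] joined_refl[of E x] by blast
    then show "x \<in> A \<and> P A \<and> (\<nexists>B. P B \<and> A \<subset> B)"
      using conn A by auto
  qed
qed

lemma vedgesD: "{u, w} \<in> vedges C \<Longrightarrow> w \<in> verts C \<and> snd u = snd w"
  by (auto simp: vedges_def vedges_minor_def verts_def V_minor_def doubleton_eq_iff)

lemma hedgesD: "{u, w} \<in> hedges C \<Longrightarrow> w \<in> verts C \<and> fst u = fst w"
  by (auto simp: hedges_def hedges_minor_def verts_def V_minor_def doubleton_eq_iff)

lemma max_vertical_iff:
  "x \<in> verts C \<Longrightarrow> x \<in> A \<and> A \<in> max_vertical C \<longleftrightarrow> A = conn (vedges C) x"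
  unfolding max_vertical_def mem_Collect_eq
  by (rule max_interval_iff[OF vedgesD _ vertical_interval_def])

lemma max_horizontal_iff:
  "x \<in> verts C \<Longrightarrow> x \<in> A \<and> A \<in> max_horizontal C \<longleftrightarrow> A = conn (hedges C) x"
  unfolding max_horizontal_def mem_Collect_eq
  by (rule max_interval_iff[OF hedgesD _ horizontal_interval_def])

text \<open>A row and a column meet in only one place, so the two classes of a vertex determine
  it.\<close>

lemma conn_inter:
  assumes "x \<in> verts C"
  shows "conn (hedges C) x \<inter> conn (vedges C) x = {x}"
proof -
  have mem: "x \<in> conn (hedges C) x \<inter> conn (vedges C) x" by simp
  moreover have "conn (hedges C) x \<in> max_horizontal C" "conn (vedges C) x \<in> max_vertical C"
    using max_horizontal_iff[OF assms] max_vertical_iff[OF assms] by blast+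
  ultimately obtain y where "conn (hedges C) x \<inter> conn (vedges C) x = {y}"
    using inter_max_intervals by (metis empty_iff)
  with mem show ?thesis by simp
qed

text \<open>All vertices of one class give the same predicate \<open>joined E x\<close>, so the
  choice depends on the class alone.\<close>

definition ccode :: "var set set \<Rightarrow> var \<Rightarrow> nat" where
  "ccode E x = prod_encode (SOME y. joined E x y)"

lemma ccode_eq_iff: "ccode E x = ccode E y \<longleftrightarrow> conn E x = conn E y"
proof
  assume "ccode E x = ccode E y"
  then have eq: "(SOME z. joined E y z) = (SOME z. joined E x z)"
    by (simp add: ccode_def)
  have some: "joined E z (SOME y. joined E z y)" for z
    by (rule someI[of _ z]) simp
  \<comment> \<open>The commonly chosen vertex is joined to both.\<close>
  from some[of x] some[of y] have "joined E x y"
    unfolding eq by (rule joined_trans[OF _ joined_sym])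
  then show "conn E x = conn E y" by (simp only: conn_eq_iff)
next
  assume "conn E x = conn E y"
  then have "joined E x = joined E y" by (auto simp: fun_eq_iff set_eq_iff)
  then show "ccode E x = ccode E y" by (simp add: ccode_def)
qed

section \<open>Cycles of G(C) as alternating cycles of vertices\<close>

abbreviation graph_cycle :: "minor set \<Rightarrow> var list \<Rightarrow> var list \<Rightarrow> bool" where
  "graph_cycle C \<equiv> alt_cycle (ccode (hedges C)) (ccode (vedges C))"

lemma G_edges_iff:
  "{Inl H, Inr W} \<in> G_edges C \<longleftrightarrow> H \<in> max_horizontal C \<and> W \<in> max_vertical C \<and> H \<inter> W \<noteq> {}"
  by (auto simp: G_edges_def doubleton_eq_iff)

text \<open>An edge of G(C) can be recovered from the meeting point of its two intervals.\<close>

lemma G_edge_vertex: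
  assumes "{Inl H, Inr W} \<in> G_edges C"
  defines "x \<equiv> the_elem (H \<inter> W)"
  shows "x \<in> verts C" "H = conn (hedges C) x" "W = conn (vedges C) x"
proof -
  obtain y where y: "y \<in> verts C" "H \<inter> W = {y}"
    using assms(1) inter_max_intervals[of H C W] by (auto simp: G_edges_iff)
  then have "x = y" by (simp add: x_def)
  with y assms(1) show "x \<in> verts C" "H = conn (hedges C) x" "W = conn (vedges C) x"
    using max_horizontal_iff[of y C H] max_vertical_iff[of y C W] by (auto simp: G_edges_iff)
qed

text \<open>Each edge of the cycle is replaced by the vertex where its intervals meet:
  \<open>es\<close> takes the edges from an h to the next v, \<open>fs\<close> those from a v to the
  next h.\<close>

lemma G_cycle_alt_cycle:
  assumes "G_cycle C hs vs"
  obtains es fs where "graph_cycle C es fs" "set es \<subseteq> verts C" "set fs \<subseteq> verts C"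
    "f_cycle hs vs = Poly_Mapping.single (lmon es) 1 - Poly_Mapping.single (lmon fs) (1::'k::field)"
proof -
  define r where "r = length hs"
  define es where "es = map (\<lambda>k. the_elem (hs ! k \<inter> vs ! k)) [0..<r]"
  define fs where "fs = map (\<lambda>k. the_elem (hs ! (Suc k mod r) \<inter> vs ! k)) [0..<r]"
  have len: "length es = r" "length fs = r" "length vs = r" "2 \<le> r"
    using assms by (auto simp: es_def fs_def r_def G_cycle_def)
  have e: "es ! k \<in> verts C" "hs ! k = conn (hedges C) (es ! k)" "vs ! k = conn (vedges C) (es ! k)"
    if "k < r" for k
    using that assms G_edge_vertex[of "hs ! k" "vs ! k" C] by (auto simp: es_def r_def G_cycle_def)
  have f: "fs ! k \<in> verts C" "hs ! (Suc k mod r) = conn (hedges C) (fs ! k)"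
      "vs ! k = conn (vedges C) (fs ! k)" if "k < r" for k
    using that assms G_edge_vertex[of "hs ! (Suc k mod r)" "vs ! k" C]
    by (auto simp: fs_def r_def G_cycle_def insert_commute)
  have hs: "hs = map (conn (hedges C)) es" and vs: "vs = map (conn (vedges C)) es"
    using e len by (auto intro!: nth_equalityI simp: r_def)
  have "distinct (map (ccode (hedges C)) es)" "distinct (map (ccode (vedges C)) es)"
    using assms hs vs by (auto simp: G_cycle_def distinct_map inj_on_def ccode_eq_iff)
  moreover have "ccode (vedges C) (fs ! k) = ccode (vedges C) (es ! k)"
      "ccode (hedges C) (fs ! k) = ccode (hedges C) (es ! (Suc k mod r))" if "k < r" for k
    unfolding ccode_eq_iff using e[of k] e[of "Suc k mod r"] f[of k] that by auto
  ultimately have "graph_cycle C es fs"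
    using len by (simp add: alt_cycle_def)
  moreover have "set es \<subseteq> verts C" "set fs \<subseteq> verts C"
    using e(1) f(1) len by (metis in_set_conv_nth subsetI)+
  moreover have "f_cycle hs vs = Poly_Mapping.single (lmon es) 1 - Poly_Mapping.single (lmon fs) (1::'k)"
    unfolding f_cycle_def prod_indet[symmetric] len
    by (simp add: r_def[symmetric] es_def fs_def)
  ultimately show ?thesis using that by blast
qed

text \<open>The converse translation: the classes of \<open>es\<close> are the intervals visited,
  and \<open>conn_inter\<close> recovers \<open>es\<close> and \<open>fs\<close> as meeting
  points.\<close>

lemma alt_cycle_G_cycle:
  assumes cyc: "graph_cycle C es fs" and sub: "set es \<subseteq> verts C" "set fs \<subseteq> verts C"
  obtains hs vs where "G_cycle C hs vs"
    "f_cycle hs vs = Poly_Mapping.single (lmon es) 1 - Poly_Mapping.single (lmon fs) (1::'k::field)"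
proof -
  define r where "r = length es"
  define hs where "hs = map (conn (hedges C)) es"
  define vs where "vs = map (conn (vedges C)) es"
  have len: "length fs = r" "length hs = r" "length vs = r" "2 \<le> r"
    using cyc by (auto simp: alt_cycle_def r_def hs_def vs_def)
  have v: "es ! k \<in> verts C" "fs ! k \<in> verts C" if "k < r" for k
    using that sub len nth_mem by (metis r_def subsetD)+
  have cl: "hs ! k = conn (hedges C) (es ! k)" "vs ! k = conn (vedges C) (es ! k)"
      "hs ! (Suc k mod r) = conn (hedges C) (fs ! k)" "vs ! k = conn (vedges C) (fs ! k)" if "k < r" for k
  proof -
    have "Suc k mod r < r"
      using len(4) by (intro mod_less_divisor) simp
    then have "Suc k mod r < length es"
      by (simp only: r_def)
    then show "hs ! k = conn (hedges C) (es ! k)" "vs ! k = conn (vedges C) (es ! k)"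
      "hs ! (Suc k mod r) = conn (hedges C) (fs ! k)" "vs ! k = conn (vedges C) (fs ! k)"
      using that cyc unfolding alt_cycle_def ccode_eq_iff r_def hs_def vs_def by simp_all
  qed
  have mem: "x \<in> verts C \<Longrightarrow> conn (hedges C) x \<in> max_horizontal C"
      "x \<in> verts C \<Longrightarrow> conn (vedges C) x \<in> max_vertical C" for x
    using max_horizontal_iff max_vertical_iff by blast+
  have edge: "{Inl (hs ! k), Inr (vs ! k)} \<in> G_edges C"
      "{Inl (hs ! (Suc k mod r)), Inr (vs ! k)} \<in> G_edges C" if "k < r" for k
  proof -
    have "es ! k \<in> hs ! k \<inter> vs ! k"
      by (simp add: cl(1,2)[OF that])
    moreover have "fs ! k \<in> hs ! (Suc k mod r) \<inter> vs ! k"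
      unfolding cl(3,4)[OF that] by simp
    moreover have "hs ! k \<in> max_horizontal C" "vs ! k \<in> max_vertical C"
        "hs ! (Suc k mod r) \<in> max_horizontal C"
      unfolding cl(1-3)[OF that] using v[OF that] mem by simp_all
    ultimately show "{Inl (hs ! k), Inr (vs ! k)} \<in> G_edges C"
      "{Inl (hs ! (Suc k mod r)), Inr (vs ! k)} \<in> G_edges C"
      unfolding G_edges_iff by blast+
  qed
  have "distinct hs" "distinct vs"
    using cyc by (auto simp: hs_def vs_def alt_cycle_def distinct_map inj_on_def ccode_eq_iff)
  moreover have "Inl ` set hs \<union> Inr ` set vs \<subseteq> G_verts C"
    using sub mem by (auto simp: G_verts_def hs_def vs_def)
  ultimately have "G_cycle C hs vs"
    using len edge by (auto simp: G_cycle_def insert_commute)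
  moreover have "the_elem (hs ! k \<inter> vs ! k) = es ! k"
      "the_elem (hs ! (Suc k mod r) \<inter> vs ! k) = fs ! k" if "k < r" for k
    using cl[OF that] v[OF that] conn_inter by (metis the_elem_eq)+
  then have "f_cycle hs vs = Poly_Mapping.single (lmon es) 1 - Poly_Mapping.single (lmon fs) (1::'k)"
    unfolding f_cycle_def prod_indet[symmetric] len r_def[symmetric] by simp
  ultimately show ?thesis using that by blast
qed

section \<open>The ideal of cycle binomials as a kernel\<close>

lemma ideal_J_ideal: "ideal (J_ideal C :: 'k::field mpol set) (poly_ring (verts C))"
proof -
  interpret cring "poly_ring (verts C) :: 'k mpol ring" by (rule cring_poly_ring)
  show ?thesis
    unfolding J_ideal_def S_ring_def
    by (rule genideal_ideal) (use f_cycle_in_S_ring in \<open>auto simp: S_ring_def\<close>)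
qed

lemma f_cycle_in_J_ideal:
  assumes "G_cycle C hs vs"
  shows "(f_cycle hs vs :: 'k::field mpol) \<in> J_ideal C"
proof -
  interpret cring "poly_ring (verts C) :: 'k mpol ring" by (rule cring_poly_ring)
  have "{f_cycle hs vs | hs vs. G_cycle C hs vs} \<subseteq> (J_ideal C :: 'k mpol set)"
    unfolding J_ideal_def S_ring_def
    by (rule genideal_self) (use f_cycle_in_S_ring in \<open>auto simp: S_ring_def\<close>)
  then show ?thesis using assms by blast
qed

lemma J_ideal_minimal:
  fixes Q :: "'k::field mpol set"
  assumes "ideal Q (poly_ring (verts C))" "\<And>hs vs. G_cycle C hs vs \<Longrightarrow> f_cycle hs vs \<in> Q"
  shows "J_ideal C \<subseteq> Q"
proof -
  interpret cring "poly_ring (verts C) :: 'k mpol ring" by (rule cring_poly_ring)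
  show ?thesis
    unfolding J_ideal_def S_ring_def
    by (rule genideal_minimal) (use assms in auto)
qed

text \<open>The two monomials of a cycle binomial have equal degree, so the generators are killed.
  Conversely the kernel is spanned by binomials of equal degree, which
  \<open>binomial_in_ideal\<close> reduces to cycles.\<close>

lemma J_ideal_eq_kernel:
  "(J_ideal C :: 'k::field mpol set) =
     {p \<in> carrier (poly_ring (verts C)). push (mdeg (ccode (hedges C)) (ccode (vedges C))) p = 0}"
    (is "_ = ?K")
proof (rule antisym)
  show "J_ideal C \<subseteq> ?K"
  proof (rule J_ideal_minimal)
    show "ideal ?K (poly_ring (verts C))"
      by (rule ideal_push_kernel) (rule mdeg_add)
    fix hs vs assume cyc: "G_cycle C hs vs"
    obtain es fs where "graph_cycle C es fs"
      "f_cycle hs vs = Poly_Mapping.single (lmon es) 1 - Poly_Mapping.single (lmon fs) (1::'k)"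
      using G_cycle_alt_cycle[OF cyc] by metis
    then show "f_cycle hs vs \<in> ?K"
      using f_cycle_in_S_ring[OF cyc, where 'k = 'k] mdeg_alt_cycle[of _ _ es fs]
      by (auto simp: S_ring_def push_diff)
  qed
  show "?K \<subseteq> J_ideal C"
  proof
    fix p assume p: "p \<in> ?K"
    show "p \<in> J_ideal C"
    proof (rule push_kernel_subset[OF ideal_J_ideal])
      fix s t
      assume "Poly_Mapping.keys s \<subseteq> verts C" "Poly_Mapping.keys t \<subseteq> verts C"
        "mdeg (ccode (hedges C)) (ccode (vedges C)) s = mdeg (ccode (hedges C)) (ccode (vedges C)) t"
      then show "Poly_Mapping.single s 1 - Poly_Mapping.single t 1 \<in> (J_ideal C :: 'k mpol set)"
      proof (rule binomial_in_ideal[OF ideal_J_ideal, rotated 2])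
        show "x = y" if "x \<in> verts C" "y \<in> verts C" "ccode (hedges C) x = ccode (hedges C) y"
          "ccode (vedges C) x = ccode (vedges C) y" for x y
          using that conn_inter[of x C] conn_inter[of y C] by (auto simp only: ccode_eq_iff)
        show "Poly_Mapping.single (lmon es) 1 - Poly_Mapping.single (lmon fs) 1 \<in> (J_ideal C :: 'k mpol set)"
          if "graph_cycle C es fs" "set es \<subseteq> verts C" "set fs \<subseteq> verts C" for es fs
          using alt_cycle_G_cycle[OF that] f_cycle_in_J_ideal by metis
      qed
    qed (use p in auto)
  qed
qed

lemma primeideal_J_ideal: "primeideal (J_ideal C :: 'k::field mpol set) (poly_ring (verts C))"
  unfolding J_ideal_eq_kernel by (rule primeideal_push_kernel) (rule mdeg_add)

text \<open>Monomials are sent to monomials, which are nonzero. Hence variables can be cancelled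
  modulo any prime ideal inside \<open>J_ideal C\<close>.\<close>

lemma monomial_notin_J_ideal: "Poly_Mapping.single t (1::'k::field) \<notin> J_ideal C"
  by (simp add: J_ideal_eq_kernel)


section \<open>Corner-interval minors\<close>

lemma corner_vertex:
  assumes "\<forall>d\<in>C. corner_interval d" "x \<in> verts C"
  shows "(fst x, 1) \<in> verts C"
  using assms by (auto simp: verts_def V_minor_def corner_interval_def)

lemma vertical_edge_relation:
  fixes Q :: "'k::field mpol set"
  assumes corner: "\<forall>d\<in>C. corner_interval d" and Q: "ideal Q (poly_ring X)"
    and minors: "\<And>d. d \<in> C \<Longrightarrow> f_minor d \<in> Q" and edge: "{u, w} \<in> vedges C"
  shows "indet u * indet (fst w, 1) - indet w * indet (fst u, 1) \<in> Q"
proof -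
  obtain d where d: "d \<in> C" "{u, w} \<in> vedges_minor d"
    using edge by (auto simp: vedges_def)
  have "col1 d = 1"
    using corner d(1) by (simp add: corner_interval_def)
  \<comment> \<open>An edge in column 1 gives zero; in the other column the sign depends on the
    orientation of the edge.\<close>
  then have "indet u * indet (fst w, 1) - indet w * indet (fst u, 1) \<in> {0, f_minor d, - f_minor d :: 'k mpol}"
    using d(2) by (auto simp: vedges_minor_def doubleton_eq_iff f_minor_def mult.commute)
  then show ?thesis
    using minors[OF d(1)] ideal_poly_ring_zero[OF Q] ideal_poly_ring_uminus[OF Q] by auto
qed

text \<open>Modulo \<open>Q\<close> the ratio of a variable to the corner variable of its row is
  constant along a vertical interval. Passing through an intermediate vertex requires cancelling its
  corner variable.\<close>

lemma joined_relation:
  fixes Q :: "'k::field mpol set"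
  assumes corner: "\<forall>d\<in>C. corner_interval d" and Q: "primeideal Q (poly_ring (verts C))"
    and minors: "\<And>d. d \<in> C \<Longrightarrow> f_minor d \<in> Q" and notin: "\<And>x. indet x \<notin> Q"
    and u: "u \<in> verts C" and joined: "joined (vedges C) u w"
  shows "indet u * indet (fst w, 1) - indet w * indet (fst u, 1) \<in> Q"
proof -
  have ideal: "ideal Q (poly_ring (verts C))"
    using Q by (rule primeideal.axioms)
  have "w \<in> verts C \<and> indet u * indet (fst w, 1) - indet w * indet (fst u, 1) \<in> Q"
    using joined unfolding joined_def
  proof induction
    case base
    then show ?case using u ideal_poly_ring_zero[OF ideal] by simp
  next
    case (step w z)
    let ?x = "\<lambda>y. indet y :: 'k mpol" and ?x1 = "\<lambda>y. indet (fst y, 1) :: 'k mpol"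
    have z: "z \<in> verts C"
      using step.hyps vedgesD by blast
    have carr: "?x y \<in> carrier (poly_ring (verts C))" "?x1 y \<in> carrier (poly_ring (verts C))"
      if "y \<in> verts C" for y
      using that corner_vertex[OF corner that] by (simp_all add: poly_ring_carrier)
    have "?x w * ?x1 z - ?x z * ?x1 w \<in> Q"
      by (rule vertical_edge_relation[OF corner ideal minors step.hyps(2)])
    \<comment> \<open>In this combination the terms with \<open>?x w\<close> cancel, and what
      remains is divisible by \<open>?x1 w\<close>.\<close>
    then have "?x1 z * (?x u * ?x1 w - ?x w * ?x1 u) + ?x1 u * (?x w * ?x1 z - ?x z * ?x1 w) \<in> Q"
      using step.IH z u carr
      by (intro ideal_poly_ring_add[OF ideal] ideal_poly_ring_mult[OF ideal]) auto
    also have "?x1 z * (?x u * ?x1 w - ?x w * ?x1 u) + ?x1 u * (?x w * ?x1 z - ?x z * ?x1 w) =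
        ?x1 w * (?x u * ?x1 z - ?x z * ?x1 u)"
      by (simp add: algebra_simps)
    finally have "?x1 w * (?x u * ?x1 z - ?x z * ?x1 u) \<in> Q" .
    then have "?x1 w \<in> Q \<or> ?x u * ?x1 z - ?x z * ?x1 u \<in> Q"
      using step.IH z u
      by (intro primeideal.I_prime[OF Q, unfolded poly_ring_ops] poly_ring_carrier(6,7) carr) simp_all
    then show ?case using notin z by blast
  qed
  then show ?thesis by blast
qed

text \<open>Congruences modulo an ideal multiply, by exchanging one factor at a time.\<close>

lemma prod_diff_in_ideal:
  fixes a b :: "nat \<Rightarrow> 'k::field mpol"
  assumes Q: "ideal Q (poly_ring X)"
    and ab: "\<And>k. k \<in> K \<Longrightarrow> a k \<in> carrier (poly_ring X)" "\<And>k. k \<in> K \<Longrightarrow> b k \<in> carrier (poly_ring X)"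
      "\<And>k. k \<in> K \<Longrightarrow> a k - b k \<in> Q"
  shows "prod a K - prod b K \<in> Q"
  using ab
proof (induction K rule: infinite_finite_induct)
  case (insert i K)
  have "a i * (prod a K - prod b K) + prod b K * (a i - b i) \<in> Q"
    using insert
    by (intro ideal_poly_ring_add[OF Q] ideal_poly_ring_mult[OF Q] prod_in_poly_ring) auto
  then show ?case
    using insert.hyps by (simp add: algebra_simps)
qed (simp_all add: ideal_poly_ring_zero[OF Q])

text \<open>In the product of the relations \<open>joined_relation\<close> along the cycle the corner variables
  contribute the same factor to both sides, because consecutive vertices of a row share one.\<close>

lemma f_cycle_in_prime:
  fixes Q :: "'k::field mpol set"
  assumes corner: "\<forall>d\<in>C. corner_interval d" and Q: "primeideal Q (poly_ring (verts C))"
    and minors: "\<And>d. d \<in> C \<Longrightarrow> f_minor d \<in> Q" and notin: "\<And>t. Poly_Mapping.single t 1 \<notin> Q"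
    and cyc: "G_cycle C hs vs"
  shows "f_cycle hs vs \<in> Q"
proof -
  have ideal: "ideal Q (poly_ring (verts C))"
    using Q by (rule primeideal.axioms)
  obtain es fs where ef: "graph_cycle C es fs" "set es \<subseteq> verts C" "set fs \<subseteq> verts C"
      "f_cycle hs vs = Poly_Mapping.single (lmon es) 1 - Poly_Mapping.single (lmon fs) (1::'k)"
    using cyc by (rule G_cycle_alt_cycle)
  let ?r = "length es"
  let ?x = "\<lambda>y. indet y :: 'k mpol" and ?x1 = "\<lambda>y. indet (fst y, 1) :: 'k mpol"
  have len: "length fs = ?r" using ef(1) by (simp add: alt_cycle_def)
  have v: "es ! k \<in> verts C" "fs ! k \<in> verts C" if "k < ?r" for k
    using that ef len nth_mem by (metis subsetD)+
  have cls: "ccode (vedges C) (fs ! k) = ccode (vedges C) (es ! k)"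
      "ccode (hedges C) (fs ! k) = ccode (hedges C) (es ! (Suc k mod ?r))" if "k < ?r" for k
    using ef(1) that unfolding alt_cycle_def by blast+
  \<comment> \<open>Horizontal edges stay in one row, so consecutive vertices share their corner
    variable.\<close>
  have row: "fst (fs ! k) = fst (es ! (Suc k mod ?r))" if "k < ?r" for k
  proof -
    have "joined (hedges C) (fs ! k) (es ! (Suc k mod ?r))"
      using cls(2)[OF that] unfolding ccode_eq_iff conn_eq_iff .
    then show ?thesis
      unfolding joined_def by induction (use hedgesD in fastforce)+
  qed
  have col: "joined (vedges C) (es ! k) (fs ! k)" if "k < ?r" for k
    using cls(1)[OF that] unfolding ccode_eq_iff conn_eq_iff by (rule joined_sym)
  have carr: "?x y \<in> carrier (poly_ring (verts C))" "?x1 y \<in> carrier (poly_ring (verts C))"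
    if "y \<in> verts C" for y
    using that corner_vertex[OF corner that] by (simp_all add: poly_ring_carrier)
  have "(\<Prod>k<?r. ?x1 (fs ! k)) = (\<Prod>k<?r. ?x1 (es ! (Suc k mod ?r)))"
    using row by (intro prod.cong) auto
  also have "\<dots> = (\<Prod>k<?r. ?x1 (es ! k))"
    by (rule prod.reindex_bij_betw[OF bij_betw_Suc_mod])
  finally have corners: "(\<Prod>k<?r. ?x1 (fs ! k)) = (\<Prod>k<?r. ?x1 (es ! k))" .
  have "(\<Prod>k<?r. ?x (es ! k) * ?x1 (fs ! k)) - (\<Prod>k<?r. ?x (fs ! k) * ?x1 (es ! k)) \<in> Q"
    using v col notin
    by (intro prod_diff_in_ideal[OF ideal] joined_relation[OF corner Q minors] poly_ring_carrier(7) carr)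
      (simp_all add: indet_def)
  also have "(\<Prod>k<?r. ?x (es ! k) * ?x1 (fs ! k)) - (\<Prod>k<?r. ?x (fs ! k) * ?x1 (es ! k)) =
      (\<Prod>k<?r. ?x1 (es ! k)) * f_cycle hs vs"
    unfolding prod.distrib corners ef(4) prod_indet[symmetric] len by (simp add: algebra_simps)
  finally have "(\<Prod>k<?r. ?x1 (es ! k)) * f_cycle hs vs \<in> Q" .
  then have "(\<Prod>k<?r. ?x1 (es ! k)) \<in> Q \<or> f_cycle hs vs \<in> Q"
    using v f_cycle_in_S_ring[OF cyc]
    by (intro primeideal.I_prime[OF Q, unfolded poly_ring_ops] prod_in_poly_ring carr)
      (simp_all add: S_ring_def)
  \<comment> \<open>The factor to be cancelled is a single monomial, so \<open>notin\<close>
    excludes it directly.\<close>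
  moreover have "(\<Prod>k<?r. ?x1 (es ! k)) = Poly_Mapping.single (lmon (map (\<lambda>y. (fst y, 1)) es)) 1"
    by (simp flip: prod_indet)
  ultimately show ?thesis using notin by auto
qed

text \<open>The endpoints of an edge of \<open>d\<close> share a class, so both terms of the minor
  have equal degree; the kernel description then gives membership without exhibiting a
  cycle.\<close>

lemma f_minor_in_J_ideal:
  assumes "d \<in> C"
  shows "(f_minor d :: 'k::field mpol) \<in> J_ideal C"
proof -
  have h: "ccode (hedges C) (a d, col1 d) = ccode (hedges C) (a d, col2 d)" if "a = row1 \<or> a = row2" for a
  proof -
    have "{(a d, col1 d), (a d, col2 d)} \<in> hedges C"
      using assms that by (auto simp: hedges_def hedges_minor_def)
    then show ?thesis
      unfolding ccode_eq_iff conn_eq_iff unfolding joined_def by (rule r_into_rtranclp)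
  qed
  have v: "ccode (vedges C) (row1 d, b d) = ccode (vedges C) (row2 d, b d)" if "b = col1 \<or> b = col2" for b
  proof -
    have "{(row1 d, b d), (row2 d, b d)} \<in> vedges C"
      using assms that by (auto simp: vedges_def vedges_minor_def)
    then show ?thesis
      unfolding ccode_eq_iff conn_eq_iff unfolding joined_def by (rule r_into_rtranclp)
  qed
  have "push (mdeg (ccode (hedges C)) (ccode (vedges C))) (f_minor d :: 'k mpol) = 0"
    by (simp add: f_minor_def indet_def mult_single push_diff mdeg_add h v add_ac)
  then show ?thesis
    using f_minor_in_S_ring[OF assms] by (simp add: J_ideal_eq_kernel S_ring_def)
qed

theorem lemma3p8:
  fixes m n :: nat and C :: "minor set"
  assumes "\<forall>d\<in>C. is_minor m n d \<and> corner_interval d"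
  shows "minimal_prime_of (J_ideal C :: ('k::field mpol) set) (I_ideal C) (S_ring C)"
proof -
  interpret cring "poly_ring (verts C) :: 'k mpol ring" by (rule cring_poly_ring)
  have corner: "\<forall>d\<in>C. corner_interval d"
    using assms by blast
  have "I_ideal C \<subseteq> (J_ideal C :: 'k mpol set)"
    unfolding I_ideal_def S_ring_def
    by (rule genideal_minimal[OF ideal_J_ideal]) (auto intro: f_minor_in_J_ideal)
  moreover have "Q = J_ideal C"
    if Q: "primeideal Q (poly_ring (verts C))" "I_ideal C \<subseteq> Q" "Q \<subseteq> J_ideal C" for Q :: "'k mpol set"
  proof -
    have "f_minor ` C \<subseteq> (I_ideal C :: 'k mpol set)"
      unfolding I_ideal_def S_ring_def
      by (rule genideal_self) (use f_minor_in_S_ring in \<open>auto simp: S_ring_def\<close>)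
    \<comment> \<open>Lying inside \<open>J_ideal C\<close>, the prime \<open>Q\<close> contains no
      monomial, as \<open>f_cycle_in_prime\<close> demands.\<close>
    then have "f_cycle hs vs \<in> Q" if "G_cycle C hs vs" for hs vs
      using Q monomial_notin_J_ideal that by (intro f_cycle_in_prime[OF corner Q(1)]) blast+
    then have "J_ideal C \<subseteq> Q"
      using Q(1) by (intro J_ideal_minimal primeideal.axioms)
    with Q(3) show ?thesis by blast
  qed
  ultimately show ?thesis
    using primeideal_J_ideal by (auto simp: minimal_prime_of_def S_ring_def)
qed

end
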